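(* Let $\Delta$ be a pure simplicial sphere of dimension $D-1$ with vertex set $V$ and let $\mathcal V=\{v_i:i\in V\}\subset\mathbb{R}^D$ be a pre-embedding of $\Delta$ with the (ICoP) property. Then: (1) All elementary cycles of length at most $4$ are simple. (2) Let $\rho$ be a codimension-two face whose elementary cycle $Z$ has length five. Then $Z$ is simple if and only if there are three consecutive (in the cyclic order of $Z$) vertices $i_1,i_2,i_3$ of $Z$ such that the unique (up to scalar) linear dependence among the vectors $\{v_i:i\in\rho\cup\{i_1,i_2,i_3\}\}$ has at $i_2$ the sign opposite to the sign it takes at $i_1$ and $i_3$.
   Context: For $X\subset V$ put $\mathcal V_X=\{v_i:i\in X\}$. $\mathcal V$ is a pre-embedding of $\Delta$ if $\mathcal V_F$ is linearly independent for every $F\in\Delta$. (ICoP): every ridge $\tau$ (face with $D-1$ vertices) is contained in exactly two facets $\sigma_1,\sigma_2$, and the cones over $\mathcal V_{\sigma_1}$ and $\mathcal V_{\sigma_2}$ lie on opposite sides of the hyperplane spanned by $\mathcal V_\tau$ (equivalently, the unique, up to scalar, linear dependence in $\mathcal V_{\sigma_1\cup\sigma_2}$ has coefficients of the same sign at the elements of $\sigma_1\setminus\tau$ and $\sigma_2\setminus\tau$). For a codimension-two face $\rho$ (face with $D-2$ vertices), its link is a cycle, called the elementary cycle with center $\rho$. The contraction $\mathcal V/\rho$ is the image of $\{v_i:i\notin\rho\}$ in $\mathbb{R}^D/\operatorname{lin}(\mathcal V_\rho)\cong\mathbb{R}^2$; it maps the elementary cycle (vertices to the images of the $v_i$, extended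 linearly on edges) to a closed polygonal curve in $\mathbb{R}^2\setminus\{0\}$. The elementary cycle is simple in $\mathcal V$ if the winding number of this curve around $0$ is $\pm1$. *)

theory Defs
  imports "HOL-Complex_Analysis.Complex_Analysis"
begin

section \<open>Pure simplicial spheres\<close>

definition abstract_complex :: "'v set \<Rightarrow> 'v set set \<Rightarrow> bool" where
  "abstract_complex V \<Delta> \<longleftrightarrow>
     finite V \<and> \<Delta> \<subseteq> Pow V \<and> {} \<in> \<Delta> \<and> (\<forall>i\<in>V. {i} \<in> \<Delta>) \<and>
     (\<forall>F\<in>\<Delta>. \<forall>G. G \<subseteq> F \<longrightarrow> G \<in> \<Delta>)"

definition facet :: "'v set set \<Rightarrow> 'v set \<Rightarrow> bool" where
  "facet \<Delta> \<sigma> \<longleftrightarrow> \<sigma> \<in> \<Delta> \<and> (\<forall>F\<in>\<Delta>. \<sigma> \<subseteq> F \<longrightarrow> F = \<sigma>)"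

definition pure_complex :: "nat \<Rightarrow> 'v set set \<Rightarrow> bool" where
  "pure_complex n \<Delta> \<longleftrightarrow> (\<forall>\<sigma>. facet \<Delta> \<sigma> \<longrightarrow> card \<sigma> = n + 1)"

text \<open>Points are given by their barycentric coordinates; the function space carries the
  product topology.\<close>

definition geometric_realization :: "'v set set \<Rightarrow> ('v \<Rightarrow> real) set" where
  "geometric_realization \<Delta> =
     {x. (\<forall>i. 0 \<le> x i) \<and> {i. x i \<noteq> 0} \<in> \<Delta> \<and> (\<Sum>i | x i \<noteq> 0. x i) = 1}"

definition pure_simplicial_sphere :: "nat \<Rightarrow> 'v set \<Rightarrow> 'v set set \<Rightarrow> bool" where
  "pure_simplicial_sphere n V \<Delta> \<longleftrightarrow>
     abstract_complex V \<Delta> \<and> pure_complex n \<Delta> \<and>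
     top_of_set (geometric_realization \<Delta>) homeomorphic_space nsphere n"

section \<open>Vector configurations\<close>

text \<open>Linear independence is that of the family indexed by \<open>F\<close>, so repeated vectors
  count as dependent.\<close>

definition pre_embedding :: "'v set set \<Rightarrow> ('v \<Rightarrow> real ^ 'd) \<Rightarrow> bool" where
  "pre_embedding \<Delta> v \<longleftrightarrow> (\<forall>F\<in>\<Delta>. inj_on v F \<and> independent (v ` F))"

text \<open>The hyperplane spanned by the vectors of a ridge is described by a normal vector \<open>a\<close>.
  The half-spaces are closed, since both cones contain the cone over the ridge.\<close>

definition ICoP :: "'v set set \<Rightarrow> ('v \<Rightarrow> real ^ 'd) \<Rightarrow> bool" where
  "ICoP \<Delta> v \<longleftrightarrow>
     (\<forall>\<tau>\<in>\<Delta>. card \<tau> + 1 = CARD('d) \<longrightarrow>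
       (\<exists>\<sigma>\<^sub>1 \<sigma>\<^sub>2. \<sigma>\<^sub>1 \<noteq> \<sigma>\<^sub>2 \<and> {\<sigma>. facet \<Delta> \<sigma> \<and> \<tau> \<subseteq> \<sigma>} = {\<sigma>\<^sub>1, \<sigma>\<^sub>2} \<and>
          (\<exists>a. a \<noteq> 0 \<and> span (v ` \<tau>) = {x. a \<bullet> x = 0} \<and>
             (\<forall>x \<in> convex_cone hull (v ` \<sigma>\<^sub>1). 0 \<le> a \<bullet> x) \<and>
             (\<forall>x \<in> convex_cone hull (v ` \<sigma>\<^sub>2). a \<bullet> x \<le> 0))))"

definition dependence :: "('v \<Rightarrow> real ^ 'd) \<Rightarrow> 'v set \<Rightarrow> ('v \<Rightarrow> real) \<Rightarrow> bool" where
  "dependence v S c \<longleftrightarrow> (\<Sum>i\<in>S. c i *\<^sub>R v i) = 0"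

definition unique_dependence :: "('v \<Rightarrow> real ^ 'd) \<Rightarrow> 'v set \<Rightarrow> ('v \<Rightarrow> real) \<Rightarrow> bool" where
  "unique_dependence v S c \<longleftrightarrow>
     dependence v S c \<and> (\<exists>i\<in>S. c i \<noteq> 0) \<and>
     (\<forall>c'. dependence v S c' \<longrightarrow> (\<exists>t. \<forall>i\<in>S. c' i = t * c i))"

section \<open>Elementary cycles\<close>

definition link :: "'v set set \<Rightarrow> 'v set \<Rightarrow> 'v set set" where
  "link \<Delta> \<rho> = {G \<in> \<Delta>. G \<inter> \<rho> = {} \<and> G \<union> \<rho> \<in> \<Delta>}"

text \<open>The list \<open>zs\<close> enumerates the vertices of the cycle in a cyclic order; it is determined
  by the cycle up to rotation and reversal.\<close>

definition elementary_cycle :: "'v set set \<Rightarrow> 'v set \<Rightarrow> 'v list \<Rightarrow> bool" where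
  "elementary_cycle \<Delta> \<rho> zs \<longleftrightarrow>
     distinct zs \<and> 3 \<le> length zs \<and>
     link \<Delta> \<rho> = {{}} \<union> {{z} | z. z \<in> set zs} \<union>
                  {{zs ! k, zs ! ((k + 1) mod length zs)} | k. k < length zs}"

fun polygonal_path :: "complex list \<Rightarrow> real \<Rightarrow> complex" where
  "polygonal_path [] = linepath 0 0"
| "polygonal_path [a] = linepath a a"
| "polygonal_path [a, b] = linepath a b"
| "polygonal_path (a # b # c # ws) = linepath a b +++ polygonal_path (b # c # ws)"

definition closed_polygon :: "complex list \<Rightarrow> real \<Rightarrow> complex" where
  "closed_polygon ws = polygonal_path (ws @ [hd ws])"

text \<open>A surjective linear map with kernel \<open>lin(v ` \<rho>)\<close> is a quotient map modulo this subspace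
  together with an identification of the quotient with the plane. Another choice composes the
  curve with a linear automorphism of the plane, which changes its winding number around 0
  at most by a sign.\<close>

definition contraction_map :: "('v \<Rightarrow> real ^ 'd) \<Rightarrow> 'v set \<Rightarrow> (real ^ 'd \<Rightarrow> complex) \<Rightarrow> bool" where
  "contraction_map v \<rho> \<pi> \<longleftrightarrow> linear \<pi> \<and> surj \<pi> \<and> {x. \<pi> x = 0} = span (v ` \<rho>)"

definition simple_in :: "('v \<Rightarrow> real ^ 'd) \<Rightarrow> 'v set \<Rightarrow> 'v list \<Rightarrow> bool" where
  "simple_in v \<rho> zs \<longleftrightarrow>
     (\<exists>\<pi>. contraction_map v \<rho> \<pi> \<and>
          winding_number (closed_polygon (map (\<lambda>i. \<pi> (v i)) zs)) 0 \<in> {1, -1})"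

end

theory Submission
  imports Defs
begin

text \<open>Contracting a codimension-two face \<open>\<rho>\<close> turns its elementary cycle into a closed polygon in
  the punctured plane. Each edge of the polygon joins two linearly independent vectors, and so turns
  around the origin by an angle of absolute value strictly between 0 and \<open>pi\<close>. Applied to the ridge
  \<open>insert y \<rho>\<close>, where \<open>y\<close> is a vertex of the cycle, ICoP says that the two neighbours of \<open>y\<close> lie on
  opposite sides of the line through the image of \<open>y\<close>: the polygon never changes its direction
  (\<open>ICoP_wedge_pos\<close>, \<open>elementary_cycle_same_orientation\<close>). Up to reflection all angles are positive,
  and the winding number is their sum divided by \<open>2 * pi\<close> (\<open>winding_number_closed_polygon\<close>).

  With \<open>n\<close> vertices the sum is below \<open>n * pi\<close>, so for \<open>n \<le> 4\<close> it can only be one full turn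
  (\<open>winding_number_le_4\<close>). For \<open>n = 5\<close> it is one or two full turns, and it is one exactly when some two
  successive angles together are less than \<open>pi\<close> (\<open>winding_number_5_iff\<close>). This is a statement about
  three consecutive vectors \<open>a\<close>, \<open>b\<close>, \<open>c\<close> in the plane: by Cramer's rule their dependence has the
  coefficients \<open>wedge b c\<close>, \<open>- wedge a c\<close>, \<open>wedge a b\<close>, where the outer two have the sign of the
  orientation. The middle sign is opposite exactly when \<open>wedge a c\<close> has the sign of the orientation
  too, that is, when the angle from \<open>a\<close> to \<open>c\<close> is less than \<open>pi\<close>. Dependences of the contracted vectors
  correspond to dependences of the original ones together with those of \<open>\<rho>\<close>
  (\<open>reflex_dependence_iff\<close>).\<close>

section \<open>Orientation of pairs of plane vectors\<close>

text \<open>The determinant of two plane vectors, that is, their signed parallelogram area. It is positive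
  exactly when the rotation from \<open>a\<close> to \<open>b\<close> through less than a straight angle is counterclockwise.\<close>
definition wedge :: "complex \<Rightarrow> complex \<Rightarrow> real" where
  "wedge a b = Im (cnj a * b)"

lemma wedge_scaleR_self: "wedge a (r *\<^sub>R a) = 0"
  by (simp add: wedge_def)

lemma wedge_commute: "wedge b a = - wedge a b"
  by (simp add: wedge_def algebra_simps)

lemma wedge_combination: "wedge a (x *\<^sub>R b + y *\<^sub>R c) = x * wedge a b + y * wedge a c"
  by (simp add: wedge_def algebra_simps)

lemma wedge_nonzeroD:
  assumes "wedge a b \<noteq> 0"
  shows "a \<noteq> 0" "b \<noteq> 0"
  using assms by (auto simp: wedge_def)

text \<open>Three vectors of the plane are linearly dependent with the three determinants of pairs as
  coefficients. If the first two steps turn the same way, the sign at the middle vector is therefore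
  decided by \<open>wedge a c\<close>.\<close>
lemma wedge_cramer:
  "wedge b c *\<^sub>R a + (- wedge a c) *\<^sub>R b + wedge a b *\<^sub>R c = 0"
  by (simp add: wedge_def complex_eq_iff algebra_simps)

lemma Im_divide_wedge: "Im (b / a) = wedge a b / (cmod a)\<^sup>2"
  by (simp add: wedge_def Im_divide cmod_power2 algebra_simps)

lemma wedge_zero_imp_dependent:
  assumes "wedge a b = 0"
  obtains x y where "(x, y) \<noteq> (0, 0)" "x *\<^sub>R a + y *\<^sub>R b = 0"
proof (cases "a = 0")
  case True
  then show ?thesis by (intro that[of 1 0]) auto
next
  case False
  have eq: "Re a * Im b = Im a * Re b" using assms by (simp add: wedge_def)
  show ?thesis
  proof (cases "Re a = 0")
    case True
    then have "Re b = 0" "Im a \<noteq> 0" using False eq by (auto simp: complex_eq_iff)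
    then show ?thesis using True
      by (intro that[of "- Im b" "Im a"]) (auto simp: complex_eq_iff)
  next
    case False
    then show ?thesis using eq
      by (intro that[of "- Re b" "Re a"]) (auto simp: complex_eq_iff algebra_simps)
  qed
qed

section \<open>Winding numbers of polygons\<close>

text \<open>Dividing by \<open>a\<close> moves the start of the segment to 1, and the segment then leaves the real axis
  at once. So \<open>Ln (z / a)\<close> is a primitive of \<open>1 / z\<close> along the whole segment.\<close>
lemma linepath_avoids_cut:
  assumes "wedge a b \<noteq> 0" and "z \<in> closed_segment a b"
  shows "z / a \<notin> \<real>\<^sub>\<le>\<^sub>0"
proof -
  have a: "a \<noteq> 0" using wedge_nonzeroD[OF assms(1)] by simp
  obtain u where u: "0 \<le> u" "u \<le> 1" "z = (1 - u) *\<^sub>R a + u *\<^sub>R b"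
    using assms(2) by (auto simp: in_segment)
  have *: "z / a = of_real (1 - u) + of_real u * (b / a)"
    using a by (simp add: u(3) scaleR_conv_of_real field_simps)
  have "Im (b / a) \<noteq> 0" using assms(1) a by (simp add: Im_divide_wedge)
  moreover have "Im (z / a) = u * Im (b / a)"
    by (simp only: * plus_complex.sel times_complex.sel Re_complex_of_real Im_complex_of_real)
  moreover have "z / a = 1" if "u = 0" using that by (simp only: *) simp
  ultimately show ?thesis
    by (cases "u = 0") (auto simp: complex_nonpos_Reals_iff)
qed

lemma linepath_avoids_zero:
  assumes "wedge a b \<noteq> 0"
  shows "0 \<notin> closed_segment a b"
  using linepath_avoids_cut[OF assms, of 0] by auto

lemma winding_number_linepath_Ln:
  assumes "wedge a b \<noteq> 0"
  shows "winding_number (linepath a b) 0 = Ln (b / a) / (2 * of_real pi * \<i>)"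
proof -
  have a: "a \<noteq> 0" using wedge_nonzeroD[OF assms(1)] by simp
  have "((\<lambda>w. 1 / (w - 0)) has_contour_integral
      (Ln (pathfinish (linepath a b) / a) - Ln (pathstart (linepath a b) / a))) (linepath a b)"
  proof (rule contour_integral_primitive[where S = "closed_segment a b"])
    fix z assume z: "z \<in> closed_segment a b"
    have "z \<noteq> 0" using z linepath_avoids_zero[OF assms] by auto
    then show "((\<lambda>z. Ln (z / a)) has_field_derivative 1 / (z - 0)) (at z within closed_segment a b)"
      using linepath_avoids_cut[OF assms z] a
      by (auto intro!: derivative_eq_intros simp: field_simps)
  qed auto
  then have "contour_integral (linepath a b) (\<lambda>w. 1 / (w - 0)) = Ln (b / a)"
    using a by (simp add: contour_integral_unique)
  then show ?thesis
    using linepath_avoids_zero[OF assms]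
    by (subst winding_number_valid_path) auto
qed

lemma pathstart_polygonal_path: "xs \<noteq> [] \<Longrightarrow> pathstart (polygonal_path xs) = hd xs"
  by (induction xs rule: polygonal_path.induct) auto

lemma pathfinish_polygonal_path: "xs \<noteq> [] \<Longrightarrow> pathfinish (polygonal_path xs) = last xs"
  by (induction xs rule: polygonal_path.induct) auto

lemma valid_path_polygonal_path: "valid_path (polygonal_path xs)"
proof (induction xs rule: polygonal_path.induct)
  case (4 a b c ws)
  then show ?case
    by (auto intro!: valid_path_join simp: pathstart_polygonal_path)
qed (simp_all only: polygonal_path.simps valid_path_linepath)

text \<open>The segments contribute logarithms of the quotients of successive vertices. Their imaginary
  parts are the angles by which the curve turns around the origin.\<close>
lemma winding_number_polygonal_path:
  assumes "2 \<le> length xs" and "\<And>k. Suc k < length xs \<Longrightarrow> wedge (xs ! k) (xs ! Suc k) \<noteq> 0"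
  shows "0 \<notin> path_image (polygonal_path xs) \<and>
    winding_number (polygonal_path xs) 0 =
      (\<Sum>k<length xs - 1. Ln (xs ! Suc k / xs ! k)) / (2 * of_real pi * \<i>)"
  using assms
proof (induction xs rule: polygonal_path.induct)
  case (3 a b)
  then have "wedge a b \<noteq> 0" by (metis length_Cons lessI list.size(3) nth_Cons_0 nth_Cons_Suc)
  then show ?case
    by (simp add: winding_number_linepath_Ln linepath_avoids_zero)
next
  case (4 a b c ws)
  let ?p = "polygonal_path (b # c # ws)"
  have ab: "wedge a b \<noteq> 0" using 4(3)[of 0] by simp
  have IH: "0 \<notin> path_image ?p \<and> winding_number ?p 0 =
      (\<Sum>k<length (b # c # ws) - 1. Ln ((b # c # ws) ! Suc k / (b # c # ws) ! k))
        / (2 * of_real pi * \<i>)"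
    using 4(3)[of "Suc _"] by (intro 4(1)) auto
  have start: "pathfinish (linepath a b) = pathstart ?p"
    by (simp add: pathstart_polygonal_path)
  have "winding_number (linepath a b +++ ?p) 0 = winding_number (linepath a b) 0 + winding_number ?p 0"
    using IH ab start
    by (intro winding_number_join)
      (auto simp: linepath_avoids_zero valid_path_imp_path valid_path_polygonal_path)
  moreover have "0 \<notin> path_image (linepath a b +++ ?p)"
    using IH ab start by (simp add: path_image_join linepath_avoids_zero)
  moreover have "(\<Sum>k<length (a # b # c # ws) - 1. Ln ((a # b # c # ws) ! Suc k / (a # b # c # ws) ! k))
     = Ln (b / a) + (\<Sum>k<length (b # c # ws) - 1. Ln ((b # c # ws) ! Suc k / (b # c # ws) ! k))"
    by (simp add: sum.lessThan_Suc_shift del: sum.lessThan_Suc)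
  ultimately show ?case
    using IH by (simp add: winding_number_linepath_Ln[OF ab] add_divide_distrib)
qed auto

text \<open>The signed angle, in \<open>(- pi, pi]\<close>, by which the step from vertex \<open>k\<close> to its cyclic successor
  turns around the origin.\<close>
definition turning :: "complex list \<Rightarrow> nat \<Rightarrow> real" where
  "turning ws k = Arg (ws ! ((k + 1) mod length ws) / ws ! k)"

text \<open>The winding number of a closed curve is an integer, so only the imaginary parts of the
  logarithms survive: the turning angles add up to a multiple of a full turn.\<close>
lemma winding_number_closed_polygon:
  assumes "ws \<noteq> []"
    and "\<And>k. k < length ws \<Longrightarrow> wedge (ws ! k) (ws ! ((k + 1) mod length ws)) \<noteq> 0"
  obtains m :: int where "winding_number (closed_polygon ws) 0 = of_int m"
    and "(\<Sum>k<length ws. turning ws k) = 2 * pi * of_int m"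
proof -
  let ?xs = "ws @ [hd ws]"
  let ?n = "length ws"
  have nth: "?xs ! k = ws ! k" "?xs ! Suc k = ws ! ((k + 1) mod ?n)" if "k < ?n" for k
    using that assms(1) by (auto simp: nth_append mod_Suc hd_conv_nth)
  have n: "0 < ?n" using assms(1) by simp
  then have *: "0 \<notin> path_image (polygonal_path ?xs) \<and>
      winding_number (polygonal_path ?xs) 0 =
        (\<Sum>k<length ?xs - 1. Ln (?xs ! Suc k / ?xs ! k)) / (2 * of_real pi * \<i>)"
    using assms(2) nth
    by (intro winding_number_polygonal_path) (simp_all add: Suc_leI)
  have "pathstart (polygonal_path ?xs) = pathfinish (polygonal_path ?xs)"
    by (simp add: pathstart_polygonal_path pathfinish_polygonal_path assms(1))
  then have "winding_number (polygonal_path ?xs) 0 \<in> \<int>"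
    using * by (intro integer_winding_number) (auto simp: valid_path_imp_path valid_path_polygonal_path)
  then obtain m where m: "winding_number (polygonal_path ?xs) 0 = of_int m"
    by (elim Ints_cases)
  have "(\<Sum>k<?n. Ln (ws ! ((k + 1) mod ?n) / ws ! k)) = of_int m * (2 * of_real pi * \<i>)"
    using * m by (simp add: nth field_simps)
  from arg_cong[OF this, of Im]
  have "(\<Sum>k<?n. Im (Ln (ws ! ((k + 1) mod ?n) / ws ! k))) = 2 * pi * of_int m"
    by simp
  moreover have "Im (Ln (ws ! ((k + 1) mod ?n) / ws ! k)) = turning ws k" if "k < ?n" for k
  proof -
    have "ws ! ((k + 1) mod ?n) / ws ! k \<noteq> 0"
      using wedge_nonzeroD[OF assms(2)[OF that]] by simp
    then show ?thesis by (simp add: turning_def Arg_eq_Im_Ln)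
  qed
  ultimately show ?thesis using m that[of m] by (simp add: closed_polygon_def)
qed

section \<open>Polygons that turn in one direction\<close>

lemma Arg_of_sign:
  assumes "s \<in> {1, - 1 :: real}" and "0 < s * Im u"
  shows "0 < s * Arg u" and "s * Arg u < pi"
proof -
  have "0 < s * Arg u \<and> s * Arg u < pi"
  proof (cases "s = 1")
    case True
    then show ?thesis using assms Arg_lt_pi[of u] by simp
  next
    case False
    then have "s = - 1" "Im u < 0" using assms by auto
    then show ?thesis using mpi_less_Arg[of u] Arg_neg_iff[of u] by simp
  qed
  then show "0 < s * Arg u" and "s * Arg u < pi" by auto
qed

text \<open>The sign \<open>s\<close> fixes the orientation of the curve; it is carried along so that clockwise and
  counterclockwise curves are treated at once.\<close>
lemma positively_turning_angle:
  assumes "s \<in> {1, - 1 :: real}" and "0 < s * wedge a b"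
  shows "0 < s * Arg (b / a)" and "s * Arg (b / a) < pi"
proof -
  have "0 < s * Im (b / a)"
    using assms wedge_nonzeroD[of a b]
    by (auto simp: Im_divide_wedge divide_neg_pos zero_less_divide_iff)
  then show "0 < s * Arg (b / a)" and "s * Arg (b / a) < pi"
    using Arg_of_sign[OF assms(1)] by auto
qed

text \<open>Multiplying the quotients \<open>b / a\<close> and \<open>c / b\<close> adds their arguments, so \<open>wedge a c\<close> has the
  sign of the sine of the total angle, which lies strictly between 0 and \<open>2 * pi\<close>.\<close>
lemma two_turns_lt_pi_iff:
  assumes "s \<in> {1, - 1 :: real}" and "0 < s * wedge a b" and "0 < s * wedge b c"
  shows "s * Arg (b / a) + s * Arg (c / b) < pi \<longleftrightarrow> 0 < s * wedge a c"
proof -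
  define \<theta> where "\<theta> = s * Arg (b / a) + s * Arg (c / b)"
  have nz: "a \<noteq> 0" "b \<noteq> 0" "c \<noteq> 0"
    using assms wedge_nonzeroD[of a b] wedge_nonzeroD[of b c] by auto
  have \<theta>: "0 < \<theta>" "\<theta> < 2 * pi"
    using positively_turning_angle[OF assms(1,2)] positively_turning_angle[OF assms(1,3)]
    by (auto simp: \<theta>_def)
  have "c / a = (b / a) * (c / b)" using nz by simp
  also have "\<dots> = of_real (cmod (b / a)) * exp (\<i> * of_real (Arg (b / a)))
      * (of_real (cmod (c / b)) * exp (\<i> * of_real (Arg (c / b))))"
    using nz Arg_eq[of "b / a"] Arg_eq[of "c / b"] by simp
  also have "\<dots> = of_real (cmod (b / a) * cmod (c / b)) * cis (Arg (b / a) + Arg (c / b))"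
    by (simp add: cis_conv_exp exp_add ring_distribs mult_ac del: Arg_eq)
  finally have "Im (c / a) = (cmod (b / a) * cmod (c / b)) * sin (Arg (b / a) + Arg (c / b))"
    by simp
  then have "wedge a c / (cmod a)\<^sup>2 = (cmod (b / a) * cmod (c / b)) * sin (Arg (b / a) + Arg (c / b))"
    by (simp only: Im_divide_wedge)
  moreover have "s * sin (Arg (b / a) + Arg (c / b)) = sin \<theta>"
    using assms(1) by (auto simp: \<theta>_def sin_add)
  ultimately have "s * wedge a c / (cmod a)\<^sup>2 = (cmod (b / a) * cmod (c / b)) * sin \<theta>"
    by (metis mult.left_commute times_divide_eq_right)
  moreover have "0 < cmod (b / a) * cmod (c / b)" "0 < (cmod a)\<^sup>2" using nz by auto
  ultimately have "0 < s * wedge a c \<longleftrightarrow> 0 < sin \<theta>"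
    by (metis zero_less_divide_iff zero_less_mult_iff less_asym)
  also have "\<dots> \<longleftrightarrow> \<theta> < pi"
    using \<theta> sin_gt_zero[of \<theta>] sin_le_zero[of \<theta>] by (cases "\<theta> < pi") auto
  finally show ?thesis by (simp add: \<theta>_def)
qed

text \<open>At most four angles, each strictly between 0 and \<open>pi\<close>, add up to a positive multiple of
  \<open>2 * pi\<close> that is less than \<open>4 * pi\<close>: there is exactly one full turn.\<close>
lemma winding_number_le_4:
  assumes s: "s \<in> {1, - 1 :: real}" and n: "ws \<noteq> []" "length ws \<le> 4"
    and turn: "\<And>k. k < length ws \<Longrightarrow> 0 < s * wedge (ws ! k) (ws ! ((k + 1) mod length ws))"
  shows "winding_number (closed_polygon ws) 0 \<in> {1, - 1}"
proof -
  have "\<And>k. k < length ws \<Longrightarrow> wedge (ws ! k) (ws ! ((k + 1) mod length ws)) \<noteq> 0"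
    using turn by fastforce
  then obtain m where m: "winding_number (closed_polygon ws) 0 = of_int m"
      "(\<Sum>k<length ws. turning ws k) = 2 * pi * of_int m"
    using winding_number_closed_polygon[OF n(1)] by metis
  have \<theta>: "0 < s * turning ws k" "s * turning ws k < pi" if "k < length ws" for k
    using positively_turning_angle[OF s turn[OF that]] by (simp_all add: turning_def)
  have eq: "(\<Sum>k<length ws. s * turning ws k) = 2 * pi * (s * of_int m)"
    using m(2) by (simp flip: sum_distrib_left)
  have "0 < (\<Sum>k<length ws. s * turning ws k)"
    using n \<theta> by (intro sum_pos) auto
  moreover have "(\<Sum>k<length ws. s * turning ws k) < (\<Sum>k<length ws. pi)"
    using n \<theta> by (intro sum_strict_mono) auto
  moreover have "(\<Sum>k<length ws. pi) \<le> 4 * pi" using n by simp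
  ultimately have "0 < 2 * pi * (s * of_int m)" "2 * pi * (s * of_int m) < 2 * pi * 2"
    unfolding eq by auto
  then have "0 < s * of_int m" "s * of_int m < 2"
    by (simp_all add: zero_less_mult_iff)
  then have "m = 1 \<or> m = - 1" using s by auto
  then show ?thesis using m(1) by auto
qed

text \<open>Five angles below \<open>pi\<close> can make one or two full turns. If all pairs of successive angles reached
  \<open>pi\<close>, twice the total would be at least \<open>5 * pi\<close>, which excludes a single turn. If some pair stays
  below \<open>pi\<close>, the other three angles bring the total to less than \<open>4 * pi\<close>, which excludes two.\<close>
lemma winding_number_5_iff:
  assumes s: "s \<in> {1, - 1 :: real}" and n: "length ws = 5"
    and turn: "\<And>k. k < 5 \<Longrightarrow> 0 < s * wedge (ws ! k) (ws ! ((k + 1) mod 5))"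
  shows "winding_number (closed_polygon ws) 0 \<in> {1, - 1} \<longleftrightarrow>
    (\<exists>k<5. 0 < s * wedge (ws ! k) (ws ! ((k + 2) mod 5)))"
proof -
  have "ws \<noteq> []" using n by auto
  moreover have "\<And>k. k < length ws \<Longrightarrow> wedge (ws ! k) (ws ! ((k + 1) mod length ws)) \<noteq> 0"
    using turn n by fastforce
  ultimately obtain m where m: "winding_number (closed_polygon ws) 0 = of_int m"
      "(\<Sum>k<length ws. turning ws k) = 2 * pi * of_int m"
    using winding_number_closed_polygon by metis
  define \<theta> where "\<theta> k = s * turning ws k" for k
  have \<theta>: "0 < \<theta> k" "\<theta> k < pi" if "k < 5" for k
    using positively_turning_angle[OF s turn[OF that]] n by (simp_all add: turning_def \<theta>_def)
  have two: "0 < s * wedge (ws ! k) (ws ! ((k + 2) mod 5)) \<longleftrightarrow> \<theta> k + \<theta> ((k + 1) mod 5) < pi"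
    if "k < 5" for k
  proof -
    have "(Suc k mod 5 + 1) mod 5 = (k + 2) mod 5" by presburger
    then show ?thesis
      using two_turns_lt_pi_iff[OF s turn[OF that] turn[of "(k + 1) mod 5"]] n
      by (simp add: \<theta>_def turning_def)
  qed
  define M where "M = s * of_int m"
  have eq: "\<theta> 0 + \<theta> 1 + \<theta> 2 + \<theta> 3 + \<theta> 4 = 2 * pi * M"
  proof -
    have "(\<Sum>k<5. \<theta> k) = s * (2 * pi * of_int m)"
      using m(2) n by (simp add: \<theta>_def flip: sum_distrib_left)
    then show ?thesis
      by (simp add: M_def eval_nat_numeral)
  qed
  have "0 < 2 * pi * M" "2 * pi * M < 2 * pi * 3"
    unfolding eq[symmetric] using \<theta>[of 0] \<theta>[of 1] \<theta>[of 2] \<theta>[of 3] \<theta>[of 4] by auto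
  then have M: "0 < M" "M < 3" by (simp_all add: zero_less_mult_iff)
  \<comment> \<open>\<open>M\<close> is the number of full turns, counted in the direction of \<open>s\<close>.\<close>
  then have "m \<in> {1, 2, - 1, - 2}" using s by (auto simp: M_def)
  then have M12: "M = 1 \<or> M = 2" and win: "winding_number (closed_polygon ws) 0 \<in> {1, - 1} \<longleftrightarrow> M = 1"
    using s M m(1) by (auto simp: M_def)
  have ex: "(\<exists>k<5. P k) \<longleftrightarrow> P 0 \<or> P 1 \<or> P 2 \<or> P 3 \<or> P (4::nat)" for P
    by (auto simp: eval_nat_numeral less_Suc_eq)
  have "M = 1 \<longleftrightarrow> (\<exists>k<5. \<theta> k + \<theta> ((k + 1) mod 5) < pi)"
    unfolding ex using M12 eq \<theta>[of 0] \<theta>[of 1] \<theta>[of 2] \<theta>[of 3] \<theta>[of 4]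
    by (auto simp flip: numeral_2_eq_2)
  then show ?thesis using two win by auto
qed

section \<open>Contractions of pre-embeddings\<close>

lemma pre_embedding_pairD:
  fixes v :: "'v \<Rightarrow> real ^ 'd"
  assumes "pre_embedding \<Delta> v" and "{x, y} \<union> \<rho> \<in> \<Delta>" and "{x, y} \<inter> \<rho> = {}" and "x \<noteq> y"
  shows "v y \<notin> span (insert (v x) (v ` \<rho>))" and "v x \<notin> span (v ` \<rho>)"
proof -
  have inj: "inj_on v ({x, y} \<union> \<rho>)" and ind: "independent (v ` ({x, y} \<union> \<rho>))"
    using assms(1,2) by (auto simp: pre_embedding_def)
  have notin: "v y \<notin> insert (v x) (v ` \<rho>)" "v x \<notin> v ` \<rho>"
    using inj assms(3,4) by (auto simp: inj_on_def)
  have set: "v ` ({x, y} \<union> \<rho>) = insert (v y) (insert (v x) (v ` \<rho>))" by auto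
  have "independent (insert (v y) (insert (v x) (v ` \<rho>)))"
    using ind unfolding set .
  with notin show "v y \<notin> span (insert (v x) (v ` \<rho>))" and "v x \<notin> span (v ` \<rho>)"
    by (simp_all only: independent_insert[of "v y"] independent_insert[of "v x"] if_False insert_iff not_False_eq_True)
qed

text \<open>Vectors adjoined independently to \<open>B\<close> stay independent modulo \<open>span B\<close>.\<close>
lemma span_combination_zero:
  fixes p q :: "real ^ 'd"
  assumes "q \<notin> span (insert p B)" and "p \<notin> span B" and "x *\<^sub>R p + y *\<^sub>R q \<in> span B"
  shows "x = 0" and "y = 0"
proof -
  have "x = 0 \<and> y = 0"
  proof (rule ccontr)
    assume *: "\<not> (x = 0 \<and> y = 0)"
    show False
    proof (cases "y = 0")
      case True
      then have "(1 / x) *\<^sub>R (x *\<^sub>R p) \<in> span B" using assms(3) by (intro span_scale[of "x *\<^sub>R p"]) simp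
      then show False using True * assms(2) by simp
    next
      case False
      have "x *\<^sub>R p + y *\<^sub>R q \<in> span (insert p B)"
        using assms(3) span_mono[of B "insert p B"] by auto
      then have "(1 / y) *\<^sub>R ((x *\<^sub>R p + y *\<^sub>R q) - x *\<^sub>R p) \<in> span (insert p B)"
        by (intro span_scale span_diff) (auto intro: span_base)
      then show False using False assms(1) by simp
    qed
  qed
  then show "x = 0" and "y = 0" by auto
qed

text \<open>Contracting a face keeps the vectors of the edges of its link independent; this makes the curve
  avoid the origin.\<close>
lemma contraction_wedge_nonzero:
  assumes "pre_embedding \<Delta> v" and "{x, y} \<union> \<rho> \<in> \<Delta>" and "{x, y} \<inter> \<rho> = {}" and "x \<noteq> y"
    and "contraction_map v \<rho> \<pi>"
  shows "wedge (\<pi> (v x)) (\<pi> (v y)) \<noteq> 0"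
proof
  assume "wedge (\<pi> (v x)) (\<pi> (v y)) = 0"
  then obtain r t where rt: "(r, t) \<noteq> (0, 0)" "r *\<^sub>R \<pi> (v x) + t *\<^sub>R \<pi> (v y) = 0"
    by (rule wedge_zero_imp_dependent)
  have lin: "linear \<pi>" and ker: "{u. \<pi> u = 0} = span (v ` \<rho>)"
    using assms(5) by (auto simp: contraction_map_def)
  have "\<pi> (r *\<^sub>R v x + t *\<^sub>R v y) = 0"
    using rt(2) by (simp add: linear_add[OF lin] linear_cmul[OF lin])
  then have "r *\<^sub>R v x + t *\<^sub>R v y \<in> span (v ` \<rho>)" using ker by auto
  then show False
    using rt(1) span_combination_zero[OF pre_embedding_pairD[OF assms(1-4)]] by auto
qed

lemma span_facet_UNIV:
  fixes v :: "'v \<Rightarrow> real ^ 'd"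
  assumes "pre_embedding \<Delta> v" and "\<sigma> \<in> \<Delta>" and "card \<sigma> = CARD('d)"
  shows "span (v ` \<sigma>) = UNIV"
proof -
  have inj: "inj_on v \<sigma>" and ind: "independent (v ` \<sigma>)"
    using assms by (auto simp: pre_embedding_def)
  have "card (v ` \<sigma>) = DIM(real ^ 'd)" using assms(3) inj by (simp add: card_image)
  then show ?thesis
    using ind card_eq_dim[of "v ` \<sigma>" "UNIV :: (real ^ 'd) set"] independent_bound[OF ind]
    by (auto simp: dim_UNIV)
qed

text \<open>Faces are independent, so none has more vertices than the dimension.\<close>
lemma facet_if_card_eq_dim:
  fixes v :: "'v \<Rightarrow> real ^ 'd"
  assumes "pre_embedding \<Delta> v" and "\<sigma> \<in> \<Delta>" and "card \<sigma> = CARD('d)"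
  shows "facet \<Delta> \<sigma>"
  unfolding facet_def
proof (intro conjI ballI impI)
  fix F assume F: "F \<in> \<Delta>" "\<sigma> \<subseteq> F"
  have inj: "inj_on v F" and ind: "independent (v ` F)"
    using assms(1) F by (auto simp: pre_embedding_def)
  have "finite (v ` F)" "card (v ` F) \<le> CARD('d)"
    using independent_bound[OF ind] by simp_all
  then have "finite F" "card F \<le> card \<sigma>"
    using inj assms(3) by (simp_all add: card_image finite_image_iff)
  then show "F = \<sigma>" using F(2) card_subset_eq[of F \<sigma>] card_mono[of F \<sigma>] by auto
qed (fact assms(2))

text \<open>The vectors of a facet form a basis, so a linear map can be prescribed on them: it kills the
  vectors of \<open>\<rho>\<close> and sends the other two to 1 and \<open>\<i>\<close>.\<close>
lemma contraction_map_exists: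
  fixes v :: "'v \<Rightarrow> real ^ 'd"
  assumes pre: "pre_embedding \<Delta> v" and face: "{x, y} \<union> \<rho> \<in> \<Delta>" "{x, y} \<inter> \<rho> = {}" "x \<noteq> y"
    and card: "card ({x, y} \<union> \<rho>) = CARD('d)"
  obtains \<pi> where "contraction_map v \<rho> \<pi>"
proof -
  let ?B = "insert (v y) (insert (v x) (v ` \<rho>))"
  have B: "v ` ({x, y} \<union> \<rho>) = ?B" by auto
  note new = pre_embedding_pairD[OF pre face]
  have "independent ?B" using pre face(1) B by (metis pre_embedding_def)
  then obtain \<pi> :: "real ^ 'd \<Rightarrow> complex" where lin: "linear \<pi>"
    and \<pi>: "\<forall>u\<in>?B. \<pi> u = (if u = v x then 1 else if u = v y then \<i> else 0)"
    using linear_independent_extend[of ?B "\<lambda>u. if u = v x then 1 else if u = v y then \<i> else 0"]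
    by metis
  have "v y \<noteq> v x" "v x \<notin> v ` \<rho>" "v y \<notin> v ` \<rho>"
    using new span_base[of _ "v ` \<rho>"] span_base[of _ "insert (v x) (v ` \<rho>)"] by blast+
  then have vals: "\<pi> (v x) = 1" "\<pi> (v y) = \<i>" "\<And>u. u \<in> v ` \<rho> \<Longrightarrow> \<pi> u = 0"
  proof -
    show "\<pi> (v x) = 1" "\<pi> (v y) = \<i>" using \<pi> \<open>v y \<noteq> v x\<close> by simp_all
    fix u assume u: "u \<in> v ` \<rho>"
    then have "u \<noteq> v x" "u \<noteq> v y" using \<open>v x \<notin> v ` \<rho>\<close> \<open>v y \<notin> v ` \<rho>\<close> by blast+
    then show "\<pi> u = 0" using \<pi>[THEN bspec, of u] u by simp
  qed
  have ker: "\<pi> u = 0" if "u \<in> span (v ` \<rho>)" for u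
    using linear_eq_0_on_span[OF lin vals(3) that] .
  have "u \<in> span (v ` \<rho>)" if "\<pi> u = 0" for u
  proof -
    have "u \<in> span ?B" using span_facet_UNIV[OF pre face(1) card] B by auto
    then obtain t r where "u - t *\<^sub>R v y - r *\<^sub>R v x \<in> span (v ` \<rho>)"
      by (auto simp: span_breakdown_eq)
    moreover from ker[OF this] that vals have "t = 0" "r = 0"
      by (auto simp: linear_diff[OF lin] linear_cmul[OF lin] complex_eq_iff)
    ultimately show ?thesis by simp
  qed
  moreover have "surj \<pi>"
  proof (rule surjI)
    show "\<pi> (Re z *\<^sub>R v x + Im z *\<^sub>R v y) = z" for z
      by (simp add: linear_add[OF lin] linear_cmul[OF lin] vals complex_eq_iff)
  qed
  ultimately show ?thesis using ker lin that[of \<pi>] by (auto simp: contraction_map_def)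
qed

text \<open>The hyperplane spanned by the ridge \<open>insert y \<rho>\<close> contracts to the line through the image of
  \<open>v y\<close>. Its two facets add \<open>x\<close> and \<open>z\<close>, which lie on opposite sides, so a polygon that visits
  the images of \<open>x\<close>, \<open>y\<close>, \<open>z\<close> in this order turns in the same direction in both steps.\<close>
lemma ICoP_wedge_pos:
  fixes v :: "'v \<Rightarrow> real ^ 'd"
  assumes pre: "pre_embedding \<Delta> v" and icop: "ICoP \<Delta> v"
    and card: "card \<rho> + 2 = CARD('d)"
    and y: "insert y \<rho> \<in> \<Delta>" "y \<notin> \<rho>"
    and x: "{y, x} \<union> \<rho> \<in> \<Delta>" "{y, x} \<inter> \<rho> = {}" "y \<noteq> x"
    and z: "{y, z} \<union> \<rho> \<in> \<Delta>" "{y, z} \<inter> \<rho> = {}" "y \<noteq> z"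
    and xz: "x \<noteq> z"
    and con: "contraction_map v \<rho> \<pi>"
  shows "wedge (\<pi> (v x)) (\<pi> (v y)) * wedge (\<pi> (v y)) (\<pi> (v z)) > 0"
proof -
  have fin: "finite \<rho>"
    using pre y(1) independent_bound[of "v ` insert y \<rho>"]
    by (auto simp: pre_embedding_def finite_image_iff dest!: bspec)
  have cards: "card (insert y \<rho>) + 1 = CARD('d)" "card ({y, x} \<union> \<rho>) = CARD('d)"
    "card ({y, z} \<union> \<rho>) = CARD('d)"
    using fin x z card by auto
  obtain \<sigma>\<^sub>1 \<sigma>\<^sub>2 a where \<sigma>: "{\<sigma>. facet \<Delta> \<sigma> \<and> insert y \<rho> \<subseteq> \<sigma>} = {\<sigma>\<^sub>1, \<sigma>\<^sub>2}"
    and a: "span (v ` insert y \<rho>) = {u. a \<bullet> u = 0}"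
    and pos: "\<forall>u \<in> convex_cone hull (v ` \<sigma>\<^sub>1). 0 \<le> a \<bullet> u"
    and neg: "\<forall>u \<in> convex_cone hull (v ` \<sigma>\<^sub>2). a \<bullet> u \<le> 0"
    using icop[unfolded ICoP_def, rule_format, OF y(1) cards(1)] by blast
  have "{y, x} \<union> \<rho> \<in> {\<sigma>\<^sub>1, \<sigma>\<^sub>2}" "{y, z} \<union> \<rho> \<in> {\<sigma>\<^sub>1, \<sigma>\<^sub>2}"
    unfolding \<sigma>[symmetric]
    using facet_if_card_eq_dim[OF pre x(1) cards(2)] facet_if_card_eq_dim[OF pre z(1) cards(3)]
    by auto
  moreover have "x \<notin> {y, z} \<union> \<rho>" using x z xz by blast
  then have "{y, x} \<union> \<rho> \<noteq> {y, z} \<union> \<rho>" by auto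
  ultimately have "{y, x} \<union> \<rho> = \<sigma>\<^sub>1 \<and> {y, z} \<union> \<rho> = \<sigma>\<^sub>2 \<or> {y, x} \<union> \<rho> = \<sigma>\<^sub>2 \<and> {y, z} \<union> \<rho> = \<sigma>\<^sub>1"
    by (metis insertE singletonD)
  then have "x \<in> \<sigma>\<^sub>1 \<and> z \<in> \<sigma>\<^sub>2 \<or> x \<in> \<sigma>\<^sub>2 \<and> z \<in> \<sigma>\<^sub>1"
    by (elim disjE conjE) auto
  moreover have "0 \<le> a \<bullet> v i" if "i \<in> \<sigma>\<^sub>1" for i
    using pos that hull_subset[of "v ` \<sigma>\<^sub>1" convex_cone] by blast
  moreover have "a \<bullet> v i \<le> 0" if "i \<in> \<sigma>\<^sub>2" for i
    using neg that hull_subset[of "v ` \<sigma>\<^sub>2" convex_cone] by blast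
  moreover have "a \<bullet> v x \<noteq> 0" "a \<bullet> v z \<noteq> 0"
    using pre_embedding_pairD(1)[OF pre x] pre_embedding_pairD(1)[OF pre z] a by auto
  ultimately have opp: "(a \<bullet> v x) * (a \<bullet> v z) < 0"
    by (metis mult_less_0_iff order_le_imp_less_or_eq)
  have lin: "linear \<pi>" and ker: "{u. \<pi> u = 0} = span (v ` \<rho>)"
    using con by (auto simp: contraction_map_def)
  \<comment> \<open>This combination lies in the hyperplane of the ridge, whose image is the line through the
    image of \<open>v y\<close>.\<close>
  have "a \<bullet> ((a \<bullet> v x) *\<^sub>R v z - (a \<bullet> v z) *\<^sub>R v x) = 0"
    by (simp add: inner_diff_right)
  then have "(a \<bullet> v x) *\<^sub>R v z - (a \<bullet> v z) *\<^sub>R v x \<in> span (insert (v y) (v ` \<rho>))"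
    using a by auto
  then obtain r where "(a \<bullet> v x) *\<^sub>R v z - (a \<bullet> v z) *\<^sub>R v x - r *\<^sub>R v y \<in> span (v ` \<rho>)"
    by (auto simp: span_breakdown_eq)
  then have "\<pi> ((a \<bullet> v x) *\<^sub>R v z - (a \<bullet> v z) *\<^sub>R v x - r *\<^sub>R v y) = 0" using ker by auto
  then have "(a \<bullet> v x) *\<^sub>R \<pi> (v z) + (- (a \<bullet> v z)) *\<^sub>R \<pi> (v x) = r *\<^sub>R \<pi> (v y)"
    by (simp add: linear_diff[OF lin] linear_cmul[OF lin])
  from arg_cong[OF this, of "wedge (\<pi> (v y))"]
  have eq: "(a \<bullet> v x) * wedge (\<pi> (v y)) (\<pi> (v z)) = (a \<bullet> v z) * wedge (\<pi> (v y)) (\<pi> (v x))"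
    unfolding wedge_combination by (simp add: wedge_scaleR_self)
  have "wedge (\<pi> (v y)) (\<pi> (v x)) \<noteq> 0"
    by (rule contraction_wedge_nonzero[OF pre x con])
  then have "0 < - ((a \<bullet> v x) * (a \<bullet> v z)) * (wedge (\<pi> (v y)) (\<pi> (v x)))\<^sup>2"
    using opp by (intro mult_pos_pos) auto
  also have "\<dots> = (a \<bullet> v x) * (wedge (\<pi> (v x)) (\<pi> (v y)) * ((a \<bullet> v z) * wedge (\<pi> (v y)) (\<pi> (v x))))"
    by (simp add: wedge_commute[of "\<pi> (v y)"] power2_eq_square algebra_simps)
  also have "\<dots> = (a \<bullet> v x)\<^sup>2 * (wedge (\<pi> (v x)) (\<pi> (v y)) * wedge (\<pi> (v y)) (\<pi> (v z)))"
    unfolding eq[symmetric] by (simp add: power2_eq_square)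
  finally show ?thesis by (simp add: zero_less_mult_iff)
qed

section \<open>Elementary cycles\<close>

lemma elementary_cycleD:
  assumes "elementary_cycle \<Delta> \<rho> zs"
  shows "distinct zs" and "3 \<le> length zs"
    and "k < length zs \<Longrightarrow> {zs ! k, zs ! ((k + 1) mod length zs)} \<union> \<rho> \<in> \<Delta>"
    and "k < length zs \<Longrightarrow> {zs ! k, zs ! ((k + 1) mod length zs)} \<inter> \<rho> = {}"
    and "k < length zs \<Longrightarrow> insert (zs ! k) \<rho> \<in> \<Delta>"
    and "k < length zs \<Longrightarrow> zs ! k \<noteq> zs ! ((k + 1) mod length zs)"
    and "k < length zs \<Longrightarrow> zs ! k \<noteq> zs ! ((k + 2) mod length zs)"
proof -
  show d: "distinct zs" and n: "3 \<le> length zs"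
    using assms by (auto simp: elementary_cycle_def)
  assume k: "k < length zs"
  have "{zs ! k, zs ! ((k + 1) mod length zs)} \<in> link \<Delta> \<rho>" "{zs ! k} \<in> link \<Delta> \<rho>"
    using assms k unfolding elementary_cycle_def by auto
  then show "{zs ! k, zs ! ((k + 1) mod length zs)} \<union> \<rho> \<in> \<Delta>"
    and "{zs ! k, zs ! ((k + 1) mod length zs)} \<inter> \<rho> = {}" and "insert (zs ! k) \<rho> \<in> \<Delta>"
    by (auto simp: link_def)
  have "k \<noteq> (k + 1) mod length zs" "k \<noteq> (k + 2) mod length zs"
    using k n by (auto simp: mod_if)
  then show "zs ! k \<noteq> zs ! ((k + 1) mod length zs)" and "zs ! k \<noteq> zs ! ((k + 2) mod length zs)"
    using nth_eq_iff_index_eq[OF d k mod_less_divisor] n by (metis less_le_trans zero_less_numeral)+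
qed

text \<open>The turning direction is preserved at every vertex of the cycle, hence is the same all
  along it.\<close>
lemma elementary_cycle_same_orientation:
  fixes v :: "'v \<Rightarrow> real ^ 'd"
  assumes pre: "pre_embedding \<Delta> v" and icop: "ICoP \<Delta> v" and card: "card \<rho> + 2 = CARD('d)"
    and cyc: "elementary_cycle \<Delta> \<rho> zs" and con: "contraction_map v \<rho> \<pi>"
  obtains s :: real where "s \<in> {1, - 1}"
    and "\<And>k. k < length zs \<Longrightarrow> 0 < s * wedge (\<pi> (v (zs ! k))) (\<pi> (v (zs ! ((k + 1) mod length zs))))"
proof -
  let ?n = "length zs"
  define d where "d k = wedge (\<pi> (v (zs ! k))) (\<pi> (v (zs ! ((k + 1) mod ?n))))" for k
  note E = elementary_cycleD[OF cyc]
  have step: "0 < d k * d (Suc k)" if k: "Suc k < ?n" for k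
  proof -
    have [simp]: "Suc k mod ?n = Suc k" "(Suc k + 1) mod ?n = (k + 2) mod ?n" using k by auto
    have "0 < wedge (\<pi> (v (zs ! k))) (\<pi> (v (zs ! Suc k)))
          * wedge (\<pi> (v (zs ! Suc k))) (\<pi> (v (zs ! ((k + 2) mod ?n))))"
      by (rule ICoP_wedge_pos[OF pre icop card])
        (use k E(3)[of k] E(4)[of k] E(6)[of k] E(3)[of "Suc k"] E(4)[of "Suc k"]
          E(5)[of "Suc k"] E(6)[of "Suc k"] E(7)[of k] con in \<open>auto simp: insert_commute\<close>)
    then show ?thesis by (simp add: d_def)
  qed
  have d0: "d 0 \<noteq> 0" using step[of 0] E(2) by auto
  have "0 < sgn (d 0) * d k" if "k < ?n" for k
    using that
  proof (induction k)
    case 0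
    then show ?case using d0 by (auto simp: sgn_if)
  next
    case (Suc k)
    then show ?case using step[of k] by (auto simp: zero_less_mult_iff)
  qed
  then show ?thesis using d0 that[of "sgn (d 0)"] by (auto simp: d_def sgn_if)
qed

section \<open>Linear dependences and contraction\<close>

lemma contraction_map_dependence:
  assumes con: "contraction_map v \<rho> \<pi>" and fin: "finite \<rho>" "finite T" and disj: "T \<inter> \<rho> = {}"
    and dep: "dependence v (\<rho> \<union> T) c"
  shows "(\<Sum>i\<in>T. c i *\<^sub>R \<pi> (v i)) = 0"
proof -
  have lin: "linear \<pi>" and ker: "{u. \<pi> u = 0} = span (v ` \<rho>)"
    using con by (auto simp: contraction_map_def)
  have "(\<Sum>i\<in>\<rho>. c i *\<^sub>R \<pi> (v i)) = 0"
    using ker by (intro sum.neutral) (auto intro: span_base)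
  moreover have "\<pi> (\<Sum>i\<in>\<rho> \<union> T. c i *\<^sub>R v i) = 0"
    using dep lin by (simp add: dependence_def linear_0)
  ultimately show ?thesis
    using fin disj by (simp add: sum.union_disjoint linear_add[OF lin] linear_sum[OF lin] linear_cmul[OF lin] Int_commute)
qed

text \<open>A dependence of the contracted vectors holds in the original space up to a vector of
  \<open>span (v ` \<rho>)\<close>, which the coefficients on \<open>\<rho>\<close> can absorb.\<close>
lemma contraction_map_dependence_lift:
  assumes con: "contraction_map v \<rho> \<pi>" and fin: "finite \<rho>" "finite T" and disj: "T \<inter> \<rho> = {}"
    and inj: "inj_on v \<rho>" and zero: "(\<Sum>i\<in>T. c i *\<^sub>R \<pi> (v i)) = 0"
  obtains c' where "dependence v (\<rho> \<union> T) c'" and "\<And>i. i \<in> T \<Longrightarrow> c' i = c i"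
proof -
  have lin: "linear \<pi>" and ker: "{u. \<pi> u = 0} = span (v ` \<rho>)"
    using con by (auto simp: contraction_map_def)
  have "\<pi> (\<Sum>i\<in>T. c i *\<^sub>R v i) = 0"
    using zero by (simp add: linear_sum[OF lin] linear_cmul[OF lin])
  then have "(\<Sum>i\<in>T. c i *\<^sub>R v i) \<in> span (v ` \<rho>)" using ker by auto
  then obtain b where "(\<Sum>i\<in>T. c i *\<^sub>R v i) = (\<Sum>u\<in>v ` \<rho>. b u *\<^sub>R u)"
    using fin by (auto simp: span_finite)
  then have b: "(\<Sum>i\<in>T. c i *\<^sub>R v i) = (\<Sum>i\<in>\<rho>. b (v i) *\<^sub>R v i)"
    by (simp add: sum.reindex[OF inj])
  define c' where "c' i = (if i \<in> T then c i else - b (v i))" for i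
  have "(\<Sum>i\<in>\<rho>. c' i *\<^sub>R v i) = - (\<Sum>i\<in>\<rho>. b (v i) *\<^sub>R v i)"
    using disj by (auto simp: c'_def sum_negf[symmetric] intro!: sum.cong)
  moreover have "(\<Sum>i\<in>T. c' i *\<^sub>R v i) = (\<Sum>i\<in>T. c i *\<^sub>R v i)"
    by (simp add: c'_def)
  ultimately have "dependence v (\<rho> \<union> T) c'"
    using fin disj b by (simp add: dependence_def sum.union_disjoint Int_commute)
  then show ?thesis using that[of c'] by (simp add: c'_def)
qed

lemma dependence_independent_zero:
  assumes "inj_on v S" and "independent (v ` S)" and "dependence v S c" and "i \<in> S"
  shows "c i = 0"
proof -
  have "(\<Sum>u\<in>v ` S. c (inv_into S v u) *\<^sub>R u) = 0"
    using assms(1,3) by (simp add: sum.reindex dependence_def)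
  then have "c (inv_into S v (v i)) = 0"
    using assms(2,4) by (auto simp: independent_explicit)
  then show ?thesis using assms(1,4) by simp
qed

text \<open>Subtracting the multiple of \<open>c\<close> that agrees with \<open>c'\<close> at \<open>x\<close> leaves a dependence of the
  independent vectors of \<open>S\<close>.\<close>
lemma unique_dependenceI:
  assumes fin: "finite S" and inj: "inj_on v S" and ind: "independent (v ` S)" and x: "x \<notin> S"
    and dep: "dependence v (insert x S) c" and nz: "c x \<noteq> 0"
  shows "unique_dependence v (insert x S) c"
  unfolding unique_dependence_def
proof (intro conjI allI impI)
  fix c' assume c': "dependence v (insert x S) c'"
  define t where "t = c' x / c x"
  have "(\<Sum>i\<in>insert x S. (c' i - t * c i) *\<^sub>R v i)
      = (\<Sum>i\<in>insert x S. c' i *\<^sub>R v i) - t *\<^sub>R (\<Sum>i\<in>insert x S. c i *\<^sub>R v i)"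
    by (simp add: scaleR_left_diff_distrib sum_subtractf scaleR_sum_right)
  then have "(\<Sum>i\<in>insert x S. (c' i - t * c i) *\<^sub>R v i) = 0"
    using c' dep by (simp only: dependence_def) simp
  moreover have tx: "c' x - t * c x = 0" using nz by (simp add: t_def)
  ultimately have "dependence v S (\<lambda>i. c' i - t * c i)"
    using fin x by (simp add: dependence_def)
  then have "\<forall>i\<in>S. c' i - t * c i = 0"
    using dependence_independent_zero[OF inj ind] by blast
  then have "\<forall>i\<in>insert x S. c' i = t * c i" using tx by auto
  then show "\<exists>t. \<forall>i\<in>insert x S. c' i = t * c i" by blast
qed (use dep nz in auto)

text \<open>Up to a common factor, the dependence has at \<open>x\<close>, \<open>y\<close>, \<open>z\<close> the coefficients of the dependence
  of the three contracted vectors, which are determinants by Cramer's rule. The sign at \<open>y\<close> is opposite to the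
  other two exactly when the two steps together turn by less than a straight angle.\<close>
lemma reflex_dependence_iff:
  fixes v :: "'v \<Rightarrow> real ^ 'd"
  assumes pre: "pre_embedding \<Delta> v" and con: "contraction_map v \<rho> \<pi>" and fin: "finite \<rho>"
    and xy: "{x, y} \<union> \<rho> \<in> \<Delta>" and disj: "{x, y, z} \<inter> \<rho> = {}"
    and ne: "x \<noteq> y" "y \<noteq> z" "x \<noteq> z"
    and s: "s \<in> {1, - 1 :: real}" and pos: "0 < s * wedge (\<pi> (v x)) (\<pi> (v y))"
      "0 < s * wedge (\<pi> (v y)) (\<pi> (v z))"
  shows "(\<exists>c. unique_dependence v (\<rho> \<union> {x, y, z}) c \<and>
            sgn (c x) \<noteq> 0 \<and> sgn (c z) = sgn (c x) \<and> sgn (c y) = - sgn (c x))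
     \<longleftrightarrow> 0 < s * wedge (\<pi> (v x)) (\<pi> (v z))"
proof
  assume "\<exists>c. unique_dependence v (\<rho> \<union> {x, y, z}) c \<and>
            sgn (c x) \<noteq> 0 \<and> sgn (c z) = sgn (c x) \<and> sgn (c y) = - sgn (c x)"
  then obtain c where c: "dependence v (\<rho> \<union> {x, y, z}) c" "sgn (c x) \<noteq> 0"
      "sgn (c z) = sgn (c x)" "sgn (c y) = - sgn (c x)"
    by (auto simp: unique_dependence_def)
  have "(\<Sum>i\<in>{x, y, z}. c i *\<^sub>R \<pi> (v i)) = 0"
    by (rule contraction_map_dependence[OF con fin _ disj c(1)]) simp
  then have "c y *\<^sub>R \<pi> (v y) + c z *\<^sub>R \<pi> (v z) = (- c x) *\<^sub>R \<pi> (v x)"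
    using ne by (simp add: algebra_simps eq_neg_iff_add_eq_0)
  from arg_cong[OF this, of "wedge (\<pi> (v x))"]
  have eq: "c z * (s * wedge (\<pi> (v x)) (\<pi> (v z))) = - c y * (s * wedge (\<pi> (v x)) (\<pi> (v y)))"
    unfolding wedge_combination wedge_scaleR_self using s by (auto simp: algebra_simps)
  have "c z > 0 \<and> c y < 0 \<or> c z < 0 \<and> c y > 0"
    using c(2-4) by (auto simp: sgn_if split: if_splits)
  then show "0 < s * wedge (\<pi> (v x)) (\<pi> (v z))"
  proof (elim disjE conjE)
    assume "c z > 0" "c y < 0"
    have "0 < c z * (s * wedge (\<pi> (v x)) (\<pi> (v z)))"
      unfolding eq by (rule mult_pos_pos[OF _ pos(1)]) (use \<open>c y < 0\<close> in simp)
    then show ?thesis using \<open>c z > 0\<close> by (simp add: zero_less_mult_iff)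
  next
    assume "c z < 0" "c y > 0"
    have "c z * (s * wedge (\<pi> (v x)) (\<pi> (v z))) < 0"
      unfolding eq by (rule mult_neg_pos[OF _ pos(1)]) (use \<open>c y > 0\<close> in simp)
    then show ?thesis using \<open>c z < 0\<close> by (simp add: mult_less_0_iff)
  qed
next
  assume xz: "0 < s * wedge (\<pi> (v x)) (\<pi> (v z))"
  define b where "b i = (if i = x then wedge (\<pi> (v y)) (\<pi> (v z))
      else if i = y then - wedge (\<pi> (v x)) (\<pi> (v z)) else wedge (\<pi> (v x)) (\<pi> (v y)))" for i
  have "(\<Sum>i\<in>{x, y, z}. b i *\<^sub>R \<pi> (v i)) = 0"
    using ne wedge_cramer[of "\<pi> (v y)" "\<pi> (v z)" "\<pi> (v x)"] by (simp add: b_def algebra_simps)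
  moreover have inj: "inj_on v ({x, y} \<union> \<rho>)" and ind: "independent (v ` ({x, y} \<union> \<rho>))"
    using pre xy by (auto simp: pre_embedding_def)
  moreover have "inj_on v \<rho>" using inj by (rule inj_on_subset) auto
  ultimately obtain c where c: "dependence v (\<rho> \<union> {x, y, z}) c" "\<And>i. i \<in> {x, y, z} \<Longrightarrow> c i = b i"
    using contraction_map_dependence_lift[OF con fin _ disj] by (metis finite.emptyI finite_insert)
  have vals: "c x = wedge (\<pi> (v y)) (\<pi> (v z))" "c y = - wedge (\<pi> (v x)) (\<pi> (v z))"
      "c z = wedge (\<pi> (v x)) (\<pi> (v y))"
    using ne c(2) by (auto simp: b_def)
  have join: "\<rho> \<union> {x, y, z} = insert z ({x, y} \<union> \<rho>)" by auto
  have "unique_dependence v (\<rho> \<union> {x, y, z}) c"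
    unfolding join
  proof (rule unique_dependenceI[OF _ inj ind])
    show "dependence v (insert z ({x, y} \<union> \<rho>)) c" using c(1) join by simp
  qed (use fin ne disj pos vals in auto)
  moreover have "sgn (c x) \<noteq> 0" "sgn (c z) = sgn (c x)" "sgn (c y) = - sgn (c x)"
    using s pos xz by (auto simp: vals sgn_if)
  ultimately show "\<exists>c. unique_dependence v (\<rho> \<union> {x, y, z}) c \<and>
            sgn (c x) \<noteq> 0 \<and> sgn (c z) = sgn (c x) \<and> sgn (c y) = - sgn (c x)"
    by blast
qed

lemma elementary_cycle_contraction_exists:
  fixes v :: "'v \<Rightarrow> real ^ 'd"
  assumes pre: "pre_embedding \<Delta> v" and fin: "finite \<rho>" and card: "card \<rho> + 2 = CARD('d)"
    and cyc: "elementary_cycle \<Delta> \<rho> zs"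
  obtains \<pi> where "contraction_map v \<rho> \<pi>"
proof -
  note E = elementary_cycleD[OF cyc]
  have 0: "0 < length zs" using E(2) by auto
  have "card ({zs ! 0, zs ! ((0 + 1) mod length zs)} \<union> \<rho>) = CARD('d)"
    using E(4,6)[OF 0] fin card by auto
  then show ?thesis using contraction_map_exists[OF pre E(3,4,6)[OF 0]] that by blast
qed

lemma pre_embedding_finite_face:
  fixes v :: "'v \<Rightarrow> real ^ 'd"
  assumes "pre_embedding \<Delta> v" and "F \<in> \<Delta>"
  shows "finite F"
  using assms independent_bound[of "v ` F"] by (auto simp: pre_embedding_def finite_image_iff)

section \<open>Simple elementary cycles\<close>

theorem proposition2p13:
  fixes V :: "'v set" and \<Delta> :: "'v set set" and v :: "'v \<Rightarrow> real ^ 'd"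
  assumes "pure_simplicial_sphere (CARD('d) - 1) V \<Delta>"
    and "pre_embedding \<Delta> v"
    and "ICoP \<Delta> v"
  shows "(\<forall>\<rho>\<in>\<Delta>. \<forall>zs. card \<rho> + 2 = CARD('d) \<and> elementary_cycle \<Delta> \<rho> zs \<and> length zs \<le> 4
             \<longrightarrow> simple_in v \<rho> zs) \<and>
         (\<forall>\<rho>\<in>\<Delta>. \<forall>zs. card \<rho> + 2 = CARD('d) \<and> elementary_cycle \<Delta> \<rho> zs \<and> length zs = 5
             \<longrightarrow> (simple_in v \<rho> zs \<longleftrightarrow>
                  (\<exists>k<5. let i\<^sub>1 = zs ! k; i\<^sub>2 = zs ! ((k + 1) mod 5); i\<^sub>3 = zs ! ((k + 2) mod 5) in
                     \<exists>c. unique_dependence v (\<rho> \<union> {i\<^sub>1, i\<^sub>2, i\<^sub>3}) c \<and>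
                         sgn (c i\<^sub>1) \<noteq> 0 \<and> sgn (c i\<^sub>3) = sgn (c i\<^sub>1) \<and> sgn (c i\<^sub>2) = - sgn (c i\<^sub>1))))"
proof (intro conjI ballI allI impI; elim conjE)
  note pre = assms(2) and icop = assms(3)
  fix \<rho> zs
  assume \<rho>: "\<rho> \<in> \<Delta>" and card: "card \<rho> + 2 = CARD('d)" and cyc: "elementary_cycle \<Delta> \<rho> zs"
  note E = elementary_cycleD[OF cyc]
  have fin: "finite \<rho>" using pre_embedding_finite_face[OF pre \<rho>] .
  obtain \<pi>\<^sub>0 where con0: "contraction_map v \<rho> \<pi>\<^sub>0"
    using elementary_cycle_contraction_exists[OF pre fin card cyc] .
  have nth: "map (\<lambda>i. \<pi> (v i)) zs ! (j mod length zs) = \<pi> (v (zs ! (j mod length zs)))"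
    for \<pi> :: "real ^ 'd \<Rightarrow> complex" and j
    using E(2) by (intro nth_map mod_less_divisor) auto
  {
    assume n: "length zs \<le> 4"
    obtain s where s: "s \<in> {1, - 1 :: real}"
      "\<And>k. k < length zs \<Longrightarrow> 0 < s * wedge (\<pi>\<^sub>0 (v (zs ! k))) (\<pi>\<^sub>0 (v (zs ! ((k + 1) mod length zs))))"
      using elementary_cycle_same_orientation[OF pre icop card cyc con0] by blast
    have "winding_number (closed_polygon (map (\<lambda>i. \<pi>\<^sub>0 (v i)) zs)) 0 \<in> {1, - 1}"
      by (rule winding_number_le_4[OF s(1)]) (use n E(2) s(2) nth in auto)
    then show "simple_in v \<rho> zs" using con0 by (auto simp: simple_in_def)
  }
  {
    assume n: "length zs = 5"
    let ?dep = "\<lambda>k. let i\<^sub>1 = zs ! k; i\<^sub>2 = zs ! ((k + 1) mod 5); i\<^sub>3 = zs ! ((k + 2) mod 5) in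
        \<exists>c. unique_dependence v (\<rho> \<union> {i\<^sub>1, i\<^sub>2, i\<^sub>3}) c \<and>
            sgn (c i\<^sub>1) \<noteq> 0 \<and> sgn (c i\<^sub>3) = sgn (c i\<^sub>1) \<and> sgn (c i\<^sub>2) = - sgn (c i\<^sub>1)"
    \<comment> \<open>The right-hand side does not mention \<open>\<pi>\<close>, so every contraction map decides simplicity alike;
      the direction from simplicity to the sign condition starts from an unknown one.\<close>
    have key: "winding_number (closed_polygon (map (\<lambda>i. \<pi> (v i)) zs)) 0 \<in> {1, - 1}
        \<longleftrightarrow> (\<exists>k<5. ?dep k)" if con: "contraction_map v \<rho> \<pi>" for \<pi>
    proof -
      obtain s where s: "s \<in> {1, - 1 :: real}"
        "\<And>k. k < length zs \<Longrightarrow> 0 < s * wedge (\<pi> (v (zs ! k))) (\<pi> (v (zs ! ((k + 1) mod length zs))))"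
        using elementary_cycle_same_orientation[OF pre icop card cyc con] by blast
      let ?ws = "map (\<lambda>i. \<pi> (v i)) zs"
      have "winding_number (closed_polygon ?ws) 0 \<in> {1, - 1} \<longleftrightarrow>
          (\<exists>k<5. 0 < s * wedge (?ws ! k) (?ws ! ((k + 2) mod 5)))"
        by (rule winding_number_5_iff[OF s(1)]) (use n s(2) nth[of \<pi>] in auto)
      moreover have "0 < s * wedge (?ws ! k) (?ws ! ((k + 2) mod 5)) \<longleftrightarrow> ?dep k" if k: "k < 5" for k
      proof -
        have k1: "(k + 1) mod 5 < 5" by simp
        have k2: "((k + 1) mod 5 + 1) mod 5 = (k + 2) mod 5" by presburger
        note E1 = E(3,4,6,7)[of k, unfolded n, OF k]
        note E2 = E(3,4,6)[of "(k + 1) mod 5", unfolded n k2, OF k1]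
        have "?dep k \<longleftrightarrow> 0 < s * wedge (\<pi> (v (zs ! k))) (\<pi> (v (zs ! ((k + 2) mod 5))))"
          unfolding Let_def
          by (rule reflex_dependence_iff[OF pre con fin E1(1) _ E1(3) E2(3) E1(4) s(1)])
            (use E1(2) E2(2) s(2)[of k, unfolded n, OF k] s(2)[of "(k + 1) mod 5", unfolded n k2, OF k1] in auto)
        then show ?thesis using nth[of \<pi> "k + 2"] k n by simp
      qed
      ultimately show ?thesis by blast
    qed
    show "simple_in v \<rho> zs \<longleftrightarrow> (\<exists>k<5. ?dep k)"
      using key con0 unfolding simple_in_def by blast
  }
qed

end
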